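(* Fix a nonnegative integer $b$ and a real number $c\in(b,\infty)$. The metric spaces $\mathcal P_{\mathbb N_b,c}$ and $\mathcal P_{\mathbb N_b,[b,c]}$ have the following properties. (a) $\mathcal P_{\mathbb N_b,c}$, the set of probability measures on $\mathbb N_b$ having mean $c$, is a relatively compact, separable subset of $\mathcal P_{\mathbb N_b}$. However, $\mathcal P_{\mathbb N_b,c}$ is not a closed subset of $\mathcal P_{\mathbb N_b}$ and thus is not a compact subset or a complete metric space. (b) $\mathcal P_{\mathbb N_b,[b,c]}$, the set of probability measures on $\mathbb N_b$ having mean lying in the closed interval $[b,c]$, is the closure of $\mathcal P_{\mathbb N_b,c}$ in $\mathcal P_{\mathbb N_b}$. $\mathcal P_{\mathbb N_b,[b,c]}$ is a compact, separable subset of $\mathcal P_{\mathbb N_b}$.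
   Context: $\mathbb N_b=\{n\in\mathbb Z:n\ge b\}$. $\mathcal P_{\mathbb N_b}$ is the set of all probability measures on $\mathbb N_b$, with the topology of weak convergence ($\theta^{(n)}\Rightarrow\theta$ iff $\int f\,d\theta^{(n)}\to\int f\,d\theta$ for all bounded $f:\mathbb N_b\to\mathbb R$), metrized by the Prohorov metric built from $d(x,y)=|x-y|$ on $\mathbb N_b$; it is a complete separable metric space. Subsets carry the restricted metric. *)

theory Defs
  imports "HOL-Probability.Probability"
begin

definition Nb :: "nat \<Rightarrow> int set"
  where "Nb b = {int b..}"

definition prob_Nb :: "nat \<Rightarrow> int measure set"
  where "prob_Nb b = {\<theta>. prob_space \<theta> \<and> sets \<theta> = sets (count_space (Nb b))}"

definition enlarge :: "nat \<Rightarrow> real \<Rightarrow> int set \<Rightarrow> int set"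
  where "enlarge b \<epsilon> A = {y \<in> Nb b. \<exists>x\<in>A. real_of_int \<bar>x - y\<bar> < \<epsilon>}"

definition prohorov_bounds :: "nat \<Rightarrow> int measure \<Rightarrow> int measure \<Rightarrow> real set"
  where "prohorov_bounds b \<mu> \<nu> =
    {\<epsilon>. \<epsilon> > 0 \<and> (\<forall>A\<subseteq>Nb b. measure \<mu> A \<le> measure \<nu> (enlarge b \<epsilon> A) + \<epsilon>
                         \<and> measure \<nu> A \<le> measure \<mu> (enlarge b \<epsilon> A) + \<epsilon>)}"

text \<open>
  Every subset of the discrete space \<open>Nb b\<close> is a closed Borel set, so all subsets are tested.
  Testing both inequalities makes the metric visibly symmetric.
  The value 0 off \<^const>\<open>prob_Nb\<close> is a convention: the locale \<^locale>\<open>Metric_space\<close>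
  requires nonnegativity and symmetry on the whole type.
\<close>

definition prohorov :: "nat \<Rightarrow> int measure \<Rightarrow> int measure \<Rightarrow> real"
  where "prohorov b \<mu> \<nu> =
    (if \<mu> \<in> prob_Nb b \<and> \<nu> \<in> prob_Nb b then Inf (prohorov_bounds b \<mu> \<nu>) else 0)"

definition prohorov_topology :: "nat \<Rightarrow> int measure topology"
  where "prohorov_topology b = Metric_space.mtopology (prob_Nb b) (prohorov b)"

text \<open>
  Integrability is required explicitly because the Bochner integral of a non-integrable
  function is 0, which is an admissible value of the mean when \<open>b = 0\<close>.
\<close>

definition prob_Nb_mean :: "nat \<Rightarrow> real \<Rightarrow> int measure set"
  where "prob_Nb_mean b c =
    {\<theta> \<in> prob_Nb b. integrable \<theta> real_of_int \<and> integral\<^sup>L \<theta> real_of_int = c}"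

definition prob_Nb_mean_Icc :: "nat \<Rightarrow> real \<Rightarrow> int measure set"
  where "prob_Nb_mean_Icc b c =
    {\<theta> \<in> prob_Nb b. integrable \<theta> real_of_int \<and> integral\<^sup>L \<theta> real_of_int \<in> {real b..c}}"


lemma prob_NbD:
  assumes "\<theta> \<in> prob_Nb b"
  shows "prob_space \<theta>" "sets \<theta> = Pow (Nb b)" "space \<theta> = Nb b"
  using assms sets_eq_imp_space_eq[of \<theta> "count_space (Nb b)"] by (auto simp: prob_Nb_def)

lemma enlarge_subset: "enlarge b \<epsilon> A \<subseteq> Nb b"
  by (auto simp: enlarge_def)

lemma enlarge_mono: "\<epsilon> \<le> \<delta> \<Longrightarrow> enlarge b \<epsilon> A \<subseteq> enlarge b \<delta> A"
  by (force simp: enlarge_def)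

lemma enlarge_le_1:
  assumes "0 < \<epsilon>" "\<epsilon> \<le> 1" "A \<subseteq> Nb b" shows "enlarge b \<epsilon> A = A"
proof
  show "enlarge b \<epsilon> A \<subseteq> A"
  proof
    fix y assume "y \<in> enlarge b \<epsilon> A"
    then obtain x where x: "x \<in> A" "real_of_int \<bar>x - y\<bar> < \<epsilon>"
      unfolding enlarge_def by blast
    with assms have "x = y" by linarith
    with x show "y \<in> A" by simp
  qed
  show "A \<subseteq> enlarge b \<epsilon> A"
    using assms by (force simp: enlarge_def)
qed

lemma enlarge_enlarge: "enlarge b \<delta> (enlarge b \<epsilon> A) \<subseteq> enlarge b (\<epsilon> + \<delta>) A"
proof
  fix z assume "z \<in> enlarge b \<delta> (enlarge b \<epsilon> A)"
  then obtain x y where "z \<in> Nb b" "x \<in> A" "real_of_int \<bar>x - y\<bar> < \<epsilon>" "real_of_int \<bar>y - z\<bar> < \<delta>"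
    by (auto simp: enlarge_def)
  moreover have "real_of_int \<bar>x - z\<bar> \<le> real_of_int \<bar>x - y\<bar> + real_of_int \<bar>y - z\<bar>" by linarith
  ultimately show "z \<in> enlarge b (\<epsilon> + \<delta>) A" by (force simp: enlarge_def)
qed

lemma measure_mono_prob_Nb:
  assumes "\<theta> \<in> prob_Nb b" "A \<subseteq> B" "B \<subseteq> Nb b"
  shows "measure \<theta> A \<le> measure \<theta> B"
proof -
  interpret prob_space \<theta> using assms prob_NbD by blast
  show ?thesis using assms prob_NbD by (intro finite_measure_mono) auto
qed

lemma one_in_prohorov_bounds:
  assumes "\<mu> \<in> prob_Nb b" "\<nu> \<in> prob_Nb b"
  shows "1 \<in> prohorov_bounds b \<mu> \<nu>"
proof -
  interpret M: prob_space \<mu> using assms prob_NbD by blast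
  interpret N: prob_space \<nu> using assms prob_NbD by blast
  show ?thesis
    by (auto simp: prohorov_bounds_def intro!: order_trans[OF M.prob_le_1] order_trans[OF N.prob_le_1])
qed

lemma prohorov_bounds_mono:
  assumes "\<mu> \<in> prob_Nb b" "\<nu> \<in> prob_Nb b" "\<epsilon> \<in> prohorov_bounds b \<mu> \<nu>" "\<epsilon> \<le> \<delta>"
  shows "\<delta> \<in> prohorov_bounds b \<mu> \<nu>"
proof -
  have 1: "measure \<mu> (enlarge b \<epsilon> A) \<le> measure \<mu> (enlarge b \<delta> A)" for A
    using assms by (intro measure_mono_prob_Nb[where b=b] enlarge_mono enlarge_subset) auto
  have 2: "measure \<nu> (enlarge b \<epsilon> A) \<le> measure \<nu> (enlarge b \<delta> A)" for A
    using assms by (intro measure_mono_prob_Nb[where b=b] enlarge_mono enlarge_subset) auto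
  have "0 < \<delta>" using assms(3,4) by (auto simp: prohorov_bounds_def)
  moreover have "measure \<mu> A \<le> measure \<nu> (enlarge b \<delta> A) + \<delta>
      \<and> measure \<nu> A \<le> measure \<mu> (enlarge b \<delta> A) + \<delta>" if "A \<subseteq> Nb b" for A
  proof -
    have "measure \<mu> A \<le> measure \<nu> (enlarge b \<epsilon> A) + \<epsilon>
        \<and> measure \<nu> A \<le> measure \<mu> (enlarge b \<epsilon> A) + \<epsilon>"
      using assms(3) that by (simp add: prohorov_bounds_def)
    with 1[of A] 2[of A] assms(4) show ?thesis by linarith
  qed
  ultimately show ?thesis by (simp add: prohorov_bounds_def)
qed

lemma prohorov_bounds_trans:
  assumes "\<mu> \<in> prob_Nb b" "\<nu> \<in> prob_Nb b" "\<kappa> \<in> prob_Nb b"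
    and e: "\<epsilon> \<in> prohorov_bounds b \<mu> \<nu>" and d: "\<delta> \<in> prohorov_bounds b \<nu> \<kappa>"
  shows "\<epsilon> + \<delta> \<in> prohorov_bounds b \<mu> \<kappa>"
proof -
  have "measure \<mu> A \<le> measure \<kappa> (enlarge b (\<epsilon> + \<delta>) A) + (\<epsilon> + \<delta>)" if "A \<subseteq> Nb b" for A
  proof -
    have "measure \<mu> A \<le> measure \<nu> (enlarge b \<epsilon> A) + \<epsilon>"
      using e that by (auto simp: prohorov_bounds_def)
    moreover have "measure \<nu> (enlarge b \<epsilon> A) \<le> measure \<kappa> (enlarge b \<delta> (enlarge b \<epsilon> A)) + \<delta>"
      using d enlarge_subset by (auto simp: prohorov_bounds_def)
    moreover have "measure \<kappa> (enlarge b \<delta> (enlarge b \<epsilon> A)) \<le> measure \<kappa> (enlarge b (\<epsilon> + \<delta>) A)"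
      using assms by (intro measure_mono_prob_Nb[where b=b] enlarge_enlarge enlarge_subset) auto
    ultimately show ?thesis by linarith
  qed
  moreover have "measure \<kappa> A \<le> measure \<mu> (enlarge b (\<epsilon> + \<delta>) A) + (\<epsilon> + \<delta>)" if "A \<subseteq> Nb b" for A
  proof -
    have "measure \<kappa> A \<le> measure \<nu> (enlarge b \<delta> A) + \<delta>"
      using d that by (auto simp: prohorov_bounds_def)
    moreover have "measure \<nu> (enlarge b \<delta> A) \<le> measure \<mu> (enlarge b \<epsilon> (enlarge b \<delta> A)) + \<epsilon>"
      using e enlarge_subset by (auto simp: prohorov_bounds_def)
    moreover have "measure \<mu> (enlarge b \<epsilon> (enlarge b \<delta> A)) \<le> measure \<mu> (enlarge b (\<epsilon> + \<delta>) A)"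
      using assms enlarge_enlarge[of b \<epsilon> \<delta> A]
      by (intro measure_mono_prob_Nb[where b=b] enlarge_subset) (auto simp: add.commute)
    ultimately show ?thesis by linarith
  qed
  ultimately show ?thesis using e d by (auto simp: prohorov_bounds_def)
qed

lemma prohorov_bounds_bdd_below: "bdd_below (prohorov_bounds b \<mu> \<nu>)"
  by (rule bdd_belowI[of _ 0]) (auto simp: prohorov_bounds_def)

lemma prohorov_less_iff:
  assumes "\<mu> \<in> prob_Nb b" "\<nu> \<in> prob_Nb b"
  shows "prohorov b \<mu> \<nu> < \<epsilon> \<longleftrightarrow> (\<exists>\<delta>\<in>prohorov_bounds b \<mu> \<nu>. \<delta> < \<epsilon>)"
  using assms one_in_prohorov_bounds[OF assms] prohorov_bounds_bdd_below[of b \<mu> \<nu>]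
    cInf_less_iff[of "prohorov_bounds b \<mu> \<nu>" \<epsilon>]
  by (auto simp: prohorov_def)

lemma prohorov_nonneg: "0 \<le> prohorov b \<mu> \<nu>"
proof (cases "\<mu> \<in> prob_Nb b \<and> \<nu> \<in> prob_Nb b")
  case True
  then show ?thesis
    using prohorov_less_iff[of \<mu> b \<nu> 0] by (force simp: prohorov_bounds_def not_less[symmetric])
qed (auto simp: prohorov_def)

lemma prohorov_commute: "prohorov b \<mu> \<nu> = prohorov b \<nu> \<mu>"
proof -
  have "prohorov_bounds b \<mu> \<nu> = prohorov_bounds b \<nu> \<mu>"
    by (auto simp: prohorov_bounds_def)
  then show ?thesis by (auto simp: prohorov_def)
qed

lemma measure_diff_less_prohorov:
  assumes "\<mu> \<in> prob_Nb b" "\<nu> \<in> prob_Nb b" "A \<subseteq> Nb b" "prohorov b \<mu> \<nu> < \<epsilon>" "\<epsilon> \<le> 1"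
  shows "\<bar>measure \<mu> A - measure \<nu> A\<bar> < \<epsilon>"
proof -
  obtain \<delta> where d: "\<delta> \<in> prohorov_bounds b \<mu> \<nu>" "\<delta> < \<epsilon>"
    using assms prohorov_less_iff by blast
  then have "enlarge b \<delta> A = A"
    using assms by (intro enlarge_le_1) (auto simp: prohorov_bounds_def)
  moreover have "measure \<mu> A \<le> measure \<nu> (enlarge b \<delta> A) + \<delta>
      \<and> measure \<nu> A \<le> measure \<mu> (enlarge b \<delta> A) + \<delta>"
    using d(1) assms(3) by (simp add: prohorov_bounds_def)
  ultimately have "measure \<mu> A \<le> measure \<nu> A + \<delta> \<and> measure \<nu> A \<le> measure \<mu> A + \<delta>"
    by simp
  with d show ?thesis by linarith
qed

lemma prohorov_leI:
  assumes "\<mu> \<in> prob_Nb b" "\<nu> \<in> prob_Nb b" "0 < \<epsilon>"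
    and A: "\<And>A. A \<subseteq> Nb b \<Longrightarrow> \<bar>measure \<mu> A - measure \<nu> A\<bar> \<le> \<epsilon>"
  shows "prohorov b \<mu> \<nu> \<le> \<epsilon>"
proof -
  have "\<epsilon> \<in> prohorov_bounds b \<mu> \<nu>"
  proof -
    have "measure \<mu> A \<le> measure \<nu> (enlarge b \<epsilon> A) + \<epsilon> \<and> measure \<nu> A \<le> measure \<mu> (enlarge b \<epsilon> A) + \<epsilon>"
      if "A \<subseteq> Nb b" for A
    proof -
      have sub: "A \<subseteq> enlarge b \<epsilon> A" using that \<open>0 < \<epsilon>\<close> by (force simp: enlarge_def)
      show ?thesis
        using A[OF that] measure_mono_prob_Nb[OF assms(1) sub enlarge_subset]
          measure_mono_prob_Nb[OF assms(2) sub enlarge_subset] by linarith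
    qed
    then show ?thesis using assms(3) by (auto simp: prohorov_bounds_def)
  qed
  then show ?thesis
    using assms prohorov_bounds_bdd_below by (auto simp: prohorov_def intro: cInf_lower)
qed

theorem Metric_space_prohorov: "Metric_space (prob_Nb b) (prohorov b)"
proof
  show "0 \<le> prohorov b \<mu> \<nu>" for \<mu> \<nu> by (rule prohorov_nonneg)
  show "prohorov b \<mu> \<nu> = prohorov b \<nu> \<mu>" for \<mu> \<nu> by (rule prohorov_commute)
next
  fix \<mu> \<nu> assume mn: "\<mu> \<in> prob_Nb b" "\<nu> \<in> prob_Nb b"
  interpret M: prob_space \<mu> using mn prob_NbD by blast
  interpret N: prob_space \<nu> using mn prob_NbD by blast
  show "prohorov b \<mu> \<nu> = 0 \<longleftrightarrow> \<mu> = \<nu>"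
  proof
    assume 0: "prohorov b \<mu> \<nu> = 0"
    show "\<mu> = \<nu>"
    proof (rule measure_eqI)
      show "sets \<mu> = sets \<nu>" using mn prob_NbD by metis
      fix A assume "A \<in> sets \<mu>"
      then have A: "A \<subseteq> Nb b" using mn prob_NbD by auto
      have "\<bar>measure \<mu> A - measure \<nu> A\<bar> \<le> 0"
      proof (rule field_le_epsilon)
        fix e :: real assume "0 < e"
        then have "\<bar>measure \<mu> A - measure \<nu> A\<bar> < min e 1"
          using 0 by (intro measure_diff_less_prohorov[OF mn A]) auto
        then show "\<bar>measure \<mu> A - measure \<nu> A\<bar> \<le> 0 + e" by simp
      qed
      then show "emeasure \<mu> A = emeasure \<nu> A"
        by (simp add: M.emeasure_eq_measure N.emeasure_eq_measure)
    qed
  next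
    assume "\<mu> = \<nu>"
    then have "prohorov b \<mu> \<nu> \<le> 0 + e" if "0 < e" for e
      using prohorov_leI[OF mn that] that by simp
    then have "prohorov b \<mu> \<nu> \<le> 0" by (rule field_le_epsilon)
    then show "prohorov b \<mu> \<nu> = 0" using prohorov_nonneg by (simp add: order_antisym)
  qed
next
  fix \<mu> \<nu> \<kappa> assume mnk: "\<mu> \<in> prob_Nb b" "\<nu> \<in> prob_Nb b" "\<kappa> \<in> prob_Nb b"
  show "prohorov b \<mu> \<kappa> \<le> prohorov b \<mu> \<nu> + prohorov b \<nu> \<kappa>"
  proof (rule field_le_epsilon)
    fix e :: real assume e: "0 < e"
    obtain \<epsilon> where 1: "\<epsilon> \<in> prohorov_bounds b \<mu> \<nu>" "\<epsilon> < prohorov b \<mu> \<nu> + e / 2"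
      using prohorov_less_iff[of \<mu> b \<nu> "prohorov b \<mu> \<nu> + e / 2"] mnk e by auto
    obtain \<delta> where 2: "\<delta> \<in> prohorov_bounds b \<nu> \<kappa>" "\<delta> < prohorov b \<nu> \<kappa> + e / 2"
      using prohorov_less_iff[of \<nu> b \<kappa> "prohorov b \<nu> \<kappa> + e / 2"] mnk e by auto
    have "prohorov b \<mu> \<kappa> < prohorov b \<mu> \<nu> + prohorov b \<nu> \<kappa> + e"
      using prohorov_bounds_trans[OF mnk 1(1) 2(1)] 1(2) 2(2)
      by (subst prohorov_less_iff) (use mnk in force)+
    then show "prohorov b \<mu> \<kappa> \<le> prohorov b \<mu> \<nu> + prohorov b \<nu> \<kappa> + e" by simp
  qed
qed

lemma integral_diff_bound:
  fixes f :: "int \<Rightarrow> real"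
  assumes mn: "\<mu> \<in> prob_Nb b" "\<nu> \<in> prob_Nb b" and F: "finite F" "F \<subseteq> Nb b"
    and K: "\<And>x. x \<in> Nb b \<Longrightarrow> \<bar>f x\<bar> \<le> K"
  shows "\<bar>integral\<^sup>L \<mu> f - integral\<^sup>L \<nu> f\<bar>
    \<le> K * ((\<Sum>k\<in>F. \<bar>measure \<mu> {k} - measure \<nu> {k}\<bar>) + measure \<mu> (Nb b - F) + measure \<nu> (Nb b - F))"
proof -
  have int: "integral\<^sup>L \<theta> f = (\<Sum>k\<in>F. f k * measure \<theta> {k}) + (\<integral>x. f x * indicator (Nb b - F) x \<partial>\<theta>)
      \<and> \<bar>\<integral>x. f x * indicator (Nb b - F) x \<partial>\<theta>\<bar> \<le> K * measure \<theta> (Nb b - F)"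
    if th: "\<theta> \<in> prob_Nb b" for \<theta>
  proof -
    interpret prob_space \<theta> using th prob_NbD by blast
    have s: "sets \<theta> = Pow (Nb b)" "space \<theta> = Nb b" using th prob_NbD by auto
    have meas: "g \<in> borel_measurable \<theta>" for g :: "int \<Rightarrow> real"
      by (rule measurableI) (auto simp: s)
    have i1: "integrable \<theta> (\<lambda>x. f x * indicator (Nb b - F) x)"
      by (rule integrable_const_bound[of _ "\<bar>K\<bar>"])
        (use K in \<open>auto simp: meas s indicator_def intro!: AE_I2 order_trans[OF K abs_ge_self]\<close>)
    have i2: "integrable \<theta> (\<lambda>x. f k * indicator {k} x)" if "k \<in> F" for k
      using that F by (intro integrable_mult_right) (auto simp: s emeasure_eq_measure)
    have "integral\<^sup>L \<theta> f = (\<integral>x. (\<Sum>k\<in>F. f k * indicator {k} x) + f x * indicator (Nb b - F) x \<partial>\<theta>)"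
    proof (rule Bochner_Integration.integral_cong)
      fix x assume "x \<in> space \<theta>"
      have "(\<Sum>k\<in>F. f k * indicator {k} x) = (\<Sum>k\<in>F. if k = x then f x else 0)"
        by (intro sum.cong) (auto simp: indicator_def)
      also have "\<dots> = (if x \<in> F then f x else 0)" using F by simp
      finally show "f x = (\<Sum>k\<in>F. f k * indicator {k} x) + f x * indicator (Nb b - F) x"
        using \<open>x \<in> space \<theta>\<close> by (auto simp: s)
    qed simp
    also have "\<dots> = (\<Sum>k\<in>F. f k * measure \<theta> {k}) + (\<integral>x. f x * indicator (Nb b - F) x \<partial>\<theta>)"
    proof -
      have "(\<integral>x. (\<Sum>k\<in>F. f k * indicator {k} x) \<partial>\<theta>) = (\<Sum>k\<in>F. f k * measure \<theta> {k})"
        using F i2 by (subst Bochner_Integration.integral_sum) (auto simp: s intro!: sum.cong arg_cong[where f="measure \<theta>"])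
      then show ?thesis
        using i1 i2 by (subst Bochner_Integration.integral_add) (auto intro!: Bochner_Integration.integrable_sum)
    qed
    finally have 1: "integral\<^sup>L \<theta> f = (\<Sum>k\<in>F. f k * measure \<theta> {k}) + (\<integral>x. f x * indicator (Nb b - F) x \<partial>\<theta>)" .
    have "\<bar>\<integral>x. f x * indicator (Nb b - F) x \<partial>\<theta>\<bar> \<le> (\<integral>x. \<bar>f x * indicator (Nb b - F) x\<bar> \<partial>\<theta>)"
      by (rule integral_abs_bound)
    also have "\<dots> \<le> (\<integral>x. K * indicator (Nb b - F) x \<partial>\<theta>)"
    proof (rule integral_mono)
      show "integrable \<theta> (\<lambda>x. \<bar>f x * indicator (Nb b - F) x\<bar>)" using i1 by simp
      show "integrable \<theta> (\<lambda>x. K * indicator (Nb b - F) x)"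
        by (intro integrable_mult_right) (auto simp: s emeasure_eq_measure)
    qed (use K in \<open>auto simp: s indicator_def\<close>)
    also have "\<dots> = K * measure \<theta> (Nb b - F)"
      by (simp add: s Int_absorb2)
    finally show ?thesis using 1 by blast
  qed
  have "\<bar>(\<Sum>k\<in>F. f k * measure \<mu> {k}) - (\<Sum>k\<in>F. f k * measure \<nu> {k})\<bar>
      = \<bar>\<Sum>k\<in>F. f k * (measure \<mu> {k} - measure \<nu> {k})\<bar>"
    by (simp add: sum_subtractf right_diff_distrib)
  also have "\<dots> \<le> (\<Sum>k\<in>F. K * \<bar>measure \<mu> {k} - measure \<nu> {k}\<bar>)"
    using K F by (intro order_trans[OF sum_abs] sum_mono) (auto simp: abs_mult intro!: mult_right_mono)
  also have "\<dots> = K * (\<Sum>k\<in>F. \<bar>measure \<mu> {k} - measure \<nu> {k}\<bar>)"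
    by (simp add: sum_distrib_left)
  finally show ?thesis using int[OF mn(1)] int[OF mn(2)] unfolding distrib_left by linarith
qed

lemma uniform_integral_diff:
  fixes \<theta> :: "nat \<Rightarrow> int measure"
  assumes th: "\<And>n. \<theta> n \<in> prob_Nb b" "\<theta>' \<in> prob_Nb b"
    and lim: "\<And>A. A \<subseteq> Nb b \<Longrightarrow> (\<lambda>n. measure (\<theta> n) A) \<longlonglongrightarrow> measure \<theta>' A"
    and e: "0 < e" and K: "0 < K"
  shows "\<exists>N. \<forall>n\<ge>N. \<forall>f :: int \<Rightarrow> real. (\<forall>x\<in>Nb b. \<bar>f x\<bar> \<le> K) \<longrightarrow>
           \<bar>integral\<^sup>L (\<theta> n) f - integral\<^sup>L \<theta>' f\<bar> < e"
proof -
  interpret prob_space \<theta>' using th prob_NbD by blast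
  have s: "sets \<theta>' = Pow (Nb b)" using th prob_NbD by auto
  have "(\<lambda>i. measure \<theta>' {int b + int i..}) \<longlonglongrightarrow> measure \<theta>' (\<Inter>i. {int b + int i..})"
    by (intro finite_Lim_measure_decseq) (auto simp: s Nb_def decseq_def)
  also have "(\<Inter>i. {int b + int i..}) = {}"
  proof -
    have "x \<notin> {int b + int (nat (x + 1))..}" for x by auto
    then show ?thesis by blast
  qed
  finally have "(\<lambda>i. measure \<theta>' {int b + int i..}) \<longlonglongrightarrow> 0" by simp
  then have "\<forall>\<^sub>F i in sequentially. measure \<theta>' {int b + int i..} < e / (2 * K)"
    by (rule order_tendstoD) (use e K in auto)
  then obtain i where i: "measure \<theta>' {int b + int i..} < e / (2 * K)"
    by (auto simp: eventually_sequentially)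
  define F where "F = {int b..<int b + int i}"
  have F: "finite F" "F \<subseteq> Nb b" "Nb b - F = {int b + int i..}" by (auto simp: F_def Nb_def)
  define g where "g n = K * ((\<Sum>k\<in>F. \<bar>measure (\<theta> n) {k} - measure \<theta>' {k}\<bar>)
      + measure (\<theta> n) (Nb b - F) + measure \<theta>' (Nb b - F))" for n
  have "g \<longlonglongrightarrow> K * ((\<Sum>k\<in>F. \<bar>measure \<theta>' {k} - measure \<theta>' {k}\<bar>)
      + measure \<theta>' (Nb b - F) + measure \<theta>' (Nb b - F))"
    unfolding g_def using F(2) by (intro tendsto_intros lim) auto
  moreover have "K * ((\<Sum>k\<in>F. \<bar>measure \<theta>' {k} - measure \<theta>' {k}\<bar>)
      + measure \<theta>' (Nb b - F) + measure \<theta>' (Nb b - F)) < e"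
    using i K by (simp add: F(3) field_simps)
  ultimately have "\<forall>\<^sub>F n in sequentially. g n < e" by (rule order_tendstoD)
  then obtain N where "\<And>n. n \<ge> N \<Longrightarrow> g n < e" by (auto simp: eventually_sequentially)
  moreover have "\<bar>integral\<^sup>L (\<theta> n) f - integral\<^sup>L \<theta>' f\<bar> \<le> g n"
    if "\<forall>x\<in>Nb b. \<bar>f x\<bar> \<le> K" for n and f :: "int \<Rightarrow> real"
    unfolding g_def using that by (intro integral_diff_bound th F) auto
  ultimately show ?thesis by (meson le_less_trans)
qed

lemma integral_indicator_prob_Nb:
  assumes "\<theta> \<in> prob_Nb b" "A \<subseteq> Nb b"
  shows "integral\<^sup>L \<theta> (indicator A :: int \<Rightarrow> real) = measure \<theta> A"
  using assms prob_NbD[OF assms(1)] by (simp add: Int_absorb2)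

text \<open>The Prohorov metric metrizes weak convergence.\<close>

theorem limitin_prohorov_topology_iff:
  fixes \<theta> :: "nat \<Rightarrow> int measure"
  assumes th: "\<And>n. \<theta> n \<in> prob_Nb b" "\<theta>' \<in> prob_Nb b"
  shows "limitin (prohorov_topology b) \<theta> \<theta>' sequentially \<longleftrightarrow>
    (\<forall>f :: int \<Rightarrow> real. bounded (f ` Nb b) \<longrightarrow> (\<lambda>n. integral\<^sup>L (\<theta> n) f) \<longlonglongrightarrow> integral\<^sup>L \<theta>' f)"
    (is "?L \<longleftrightarrow> ?R")
proof -
  interpret Metric_space "prob_Nb b" "prohorov b" by (rule Metric_space_prohorov)
  have L: "?L \<longleftrightarrow> (\<forall>e>0. \<exists>N. \<forall>n\<ge>N. prohorov b (\<theta> n) \<theta>' < e)"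
    unfolding prohorov_topology_def limit_metric_sequentially using th by simp
  show ?thesis
  proof
    assume l: ?L
    have lim: "(\<lambda>n. measure (\<theta> n) A) \<longlonglongrightarrow> measure \<theta>' A" if A: "A \<subseteq> Nb b" for A
    proof (rule LIMSEQ_I)
      fix e :: real assume "0 < e"
      then obtain N where "\<forall>n\<ge>N. prohorov b (\<theta> n) \<theta>' < min e 1"
        using l L by (metis min_less_iff_conj zero_less_one)
      then have "\<forall>n\<ge>N. \<bar>measure (\<theta> n) A - measure \<theta>' A\<bar> < min e 1"
        using measure_diff_less_prohorov[OF th(1) th(2) A] by (metis min.cobounded2)
      then show "\<exists>N. \<forall>n\<ge>N. norm (measure (\<theta> n) A - measure \<theta>' A) < e" by auto
    qed
    show ?R
    proof (intro allI impI LIMSEQ_I)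
      fix f :: "int \<Rightarrow> real" and e :: real assume "bounded (f ` Nb b)" "0 < e"
      from this(1) obtain K where "0 < K" "\<forall>x\<in>Nb b. \<bar>f x\<bar> \<le> K"
        by (auto simp: bounded_pos)
      with uniform_integral_diff[OF th lim \<open>0 < e\<close> \<open>0 < K\<close>]
      show "\<exists>N. \<forall>n\<ge>N. norm (integral\<^sup>L (\<theta> n) f - integral\<^sup>L \<theta>' f) < e" by auto
    qed
  next
    assume r: ?R
    have lim: "(\<lambda>n. measure (\<theta> n) A) \<longlonglongrightarrow> measure \<theta>' A" if A: "A \<subseteq> Nb b" for A
    proof -
      have "bounded ((indicator A :: int \<Rightarrow> real) ` Nb b)"
        by (rule boundedI[of _ 1]) (auto simp: indicator_def)
      then show ?thesis using r th A integral_indicator_prob_Nb by (metis (no_types, lifting) ext)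
    qed
    show ?L unfolding L
    proof (intro allI impI)
      fix e :: real assume e: "0 < e"
      obtain N where N: "\<And>n f. n \<ge> N \<Longrightarrow> \<forall>x\<in>Nb b. \<bar>f x\<bar> \<le> (1::real) \<Longrightarrow>
           \<bar>integral\<^sup>L (\<theta> n) f - integral\<^sup>L \<theta>' f\<bar> < e / 2"
        using uniform_integral_diff[OF th lim, of "e / 2" 1] e by auto
      have "prohorov b (\<theta> n) \<theta>' \<le> e / 2" if n: "n \<ge> N" for n
      proof (rule prohorov_leI[OF th])
        fix A assume A: "A \<subseteq> Nb b"
        have "\<forall>x\<in>Nb b. \<bar>indicator A x :: real\<bar> \<le> 1" by (auto simp: indicator_def)
        from N[OF n this] show "\<bar>measure (\<theta> n) A - measure \<theta>' A\<bar> \<le> e / 2"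
          unfolding integral_indicator_prob_Nb[OF th(1) A] integral_indicator_prob_Nb[OF th(2) A]
          by simp
      qed (use e in simp)
      then show "\<exists>N. \<forall>n\<ge>N. prohorov b (\<theta> n) \<theta>' < e" using e by force
    qed
  qed
qed

end

theory Submission
  imports Defs "HOL-Real_Asymp.Real_Asymp"
begin

text \<open>
  Compactness of the measures with mean at most $c$: a sequence has a subsequence whose point masses
  converge. By Markov's inequality no mass escapes to infinity, and by Fatou's lemma the mean of the
  limit is still at most $c$; on a countable discrete space convergence of point masses to a
  probability measure already implies convergence in the Prohorov metric.
  The mean may drop in the limit, however: if $\theta$ has mean $m \le c$, then
  $(1 - t_n) \theta + t_n \delta_{k_n}$ with $k_n \to \infty$ and $t_n = (c - m) / (k_n - m) \to 0$
  has mean $c$ and converges to $\theta$. Hence the closure of the measures with mean $c$ contains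
  every mean in $[b,c]$; the point mass at $b$ shows that they are not closed.
\<close>

section \<open>Separability from total boundedness\<close>

text \<open>The union of finite nets of radius 1/(n+1) over all n is countable and dense. Total
  boundedness supplies nets whose centres lie in \<open>S\<close> itself, so the union is dense in
  the subspace.\<close>

lemma (in Metric_space) mtotally_bounded_imp_separable_space:
  assumes "mtotally_bounded S"
  shows "separable_space (subtopology mtopology S)"
proof -
  have "\<exists>K. finite K \<and> K \<subseteq> S \<and> S \<subseteq> (\<Union>x\<in>K. mball x (inverse (real (Suc n))))" for n
    using assms by (simp add: mtotally_bounded_def)
  then obtain K where fin: "\<And>n. finite (K n)" and sub: "\<And>n. K n \<subseteq> S"
    and cover: "\<And>n. S \<subseteq> (\<Union>x\<in>K n. mball x (inverse (real (Suc n))))"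
    by metis
  have S: "S \<subseteq> M" by (rule mtotally_bounded_imp_subset[OF assms])
  have "S \<subseteq> mtopology closure_of (\<Union>n. K n)"
  proof
    fix x assume x: "x \<in> S"
    have "\<exists>y\<in>\<Union>n. K n. y \<in> mball x r" if "r > 0" for r
    proof -
      obtain n where n: "inverse (real (Suc n)) < r"
        using reals_Archimedean \<open>r > 0\<close> by blast
      obtain y where "y \<in> K n" "x \<in> mball y (inverse (real (Suc n)))"
        using cover[of n] x by blast
      with n have "y \<in> mball x r" by (auto simp: commute)
      with \<open>y \<in> K n\<close> show ?thesis by blast
    qed
    then show "x \<in> mtopology closure_of (\<Union>n. K n)"
      using x S by (auto simp: metric_closure_of)
  qed
  moreover have "(\<Union>n. K n) \<subseteq> S" using sub by blast
  moreover have "countable (\<Union>n. K n)" using fin by (simp add: countable_finite)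
  ultimately show ?thesis
    unfolding separable_space_def using S
    by (intro exI[of _ "\<Union>n. K n"])
      (auto simp: closure_of_subtopology Int_absorb1)
qed

section \<open>Densities, point masses and means as nonnegative integrals\<close>

lemma measurable_prob_Nb:
  assumes "\<theta> \<in> prob_Nb b" "space N = UNIV"
  shows "f \<in> measurable \<theta> N"
  using assms prob_NbD(2,3)[OF assms(1)] by (auto simp: measurable_def)

lemma density_in_prob_Nb:
  assumes "(\<integral>\<^sup>+x. p x \<partial>count_space (Nb b)) = 1"
  shows "density (count_space (Nb b)) p \<in> prob_Nb b"
proof -
  have "(\<integral>\<^sup>+x. p x * indicator (Nb b) x \<partial>count_space (Nb b)) = 1"
    unfolding assms[symmetric] by (rule nn_integral_cong) auto
  then show ?thesis by (auto simp: prob_Nb_def emeasure_density intro!: prob_spaceI)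
qed

lemma emeasure_density_count_space_singleton:
  assumes "a \<in> A"
  shows "emeasure (density (count_space A) p) {a} = p a"
proof -
  have "emeasure (density (count_space A) p) {a} = (\<integral>\<^sup>+x. p a * indicator {a} x \<partial>count_space A)"
    using assms by (subst emeasure_density) (auto intro!: nn_integral_cong simp: indicator_def)
  also have "\<dots> = p a"
    using assms by (subst nn_integral_cmult_indicator) auto
  finally show ?thesis .
qed

lemma prob_Nb_eq_density:
  assumes "\<theta> \<in> prob_Nb b"
  shows "density (count_space (Nb b)) (\<lambda>x. emeasure \<theta> {x}) = \<theta>"
  using prob_NbD(2)[OF assms]
  by (intro measure_eqI_countable[where A = "Nb b"])
    (auto simp: emeasure_density_count_space_singleton)

text \<open>Moves integrals against varying measures to the fixed counting measure on
  \<open>Nb b\<close>, with the point masses in the integrand; Fatou's lemma applies in this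
  form.\<close>

lemma nn_integral_prob_Nb:
  assumes "\<theta> \<in> prob_Nb b"
  shows "integral\<^sup>N \<theta> f = (\<integral>\<^sup>+x. emeasure \<theta> {x} * f x \<partial>count_space (Nb b))"
  by (subst prob_Nb_eq_density[OF assms, symmetric], subst nn_integral_density) auto

text \<open>All points of \<open>Nb b\<close> are nonnegative, so one equation in
  \<open>ennreal\<close> expresses both integrability and the value of the mean. The condition 0
  \<le> c keeps \<open>ennreal c\<close> from truncating a negative number to 0.\<close>

lemma prob_Nb_mean_iff:
  assumes "0 \<le> c"
  shows "\<theta> \<in> prob_Nb_mean b c \<longleftrightarrow>
    \<theta> \<in> prob_Nb b \<and> (\<integral>\<^sup>+x. ennreal (real_of_int x) \<partial>\<theta>) = ennreal c"
proof (cases "\<theta> \<in> prob_Nb b")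
  case True
  have ae: "AE x in \<theta>. 0 \<le> real_of_int x"
    using prob_NbD(3)[OF True] by (intro AE_I2) (auto simp: Nb_def)
  have meas: "real_of_int \<in> borel_measurable \<theta>" by (rule measurable_prob_Nb[OF True]) simp
  show ?thesis
    using assms True nn_integral_eq_integral[OF _ ae] has_bochner_integral_nn_integral[OF meas ae assms]
    by (auto simp: prob_Nb_mean_def has_bochner_integral_iff)
qed (simp add: prob_Nb_mean_def)

lemma integral_ge_prob_Nb:
  assumes "\<theta> \<in> prob_Nb b" "integrable \<theta> real_of_int"
  shows "real b \<le> integral\<^sup>L \<theta> real_of_int"
proof -
  interpret prob_space \<theta> using assms prob_NbD by blast
  show ?thesis
    using prob_NbD(3)[OF assms(1)] assms(2) by (intro integral_ge_const AE_I2) (auto simp: Nb_def)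
qed

text \<open>The lower end of the interval comes from \<open>integral_ge_prob_Nb\<close>. What
  remains is a one-sided bound on a nonnegative integral, the kind of condition that Fatou's lemma
  preserves in the limit.\<close>

lemma prob_Nb_mean_Icc_iff:
  assumes "0 \<le> c"
  shows "\<theta> \<in> prob_Nb_mean_Icc b c \<longleftrightarrow>
    \<theta> \<in> prob_Nb b \<and> (\<integral>\<^sup>+x. ennreal (real_of_int x) \<partial>\<theta>) \<le> ennreal c"
proof
  assume "\<theta> \<in> prob_Nb_mean_Icc b c"
  then obtain m where m: "\<theta> \<in> prob_Nb_mean b m" "real b \<le> m" "m \<le> c"
    by (auto simp: prob_Nb_mean_Icc_def prob_Nb_mean_def)
  then show "\<theta> \<in> prob_Nb b \<and> (\<integral>\<^sup>+x. ennreal (real_of_int x) \<partial>\<theta>) \<le> ennreal c"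
    using prob_Nb_mean_iff[of m \<theta> b] by (auto intro: ennreal_leI)
next
  assume *: "\<theta> \<in> prob_Nb b \<and> (\<integral>\<^sup>+x. ennreal (real_of_int x) \<partial>\<theta>) \<le> ennreal c"
  \<comment> \<open>The integral is bounded by the finite value \<open>ennreal c\<close>, hence is
    itself a real number.\<close>
  then obtain m where m: "0 \<le> m" "(\<integral>\<^sup>+x. ennreal (real_of_int x) \<partial>\<theta>) = ennreal m"
    by (metis ennreal_cases ennreal_less_top leD top.extremum_unique top_neq_ennreal)
  with * assms have "m \<le> c" by (simp add: ennreal_le_iff)
  moreover have "\<theta> \<in> prob_Nb_mean b m" using * m prob_Nb_mean_iff by blast
  ultimately show "\<theta> \<in> prob_Nb_mean_Icc b c"
    using integral_ge_prob_Nb by (auto simp: prob_Nb_mean_Icc_def prob_Nb_mean_def)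
qed

section \<open>Prohorov convergence from convergence of point masses\<close>

text \<open>A finite set \<open>F\<close> carries almost all mass of the limit. Since every measure
  involved has total mass 1, convergence on the points of \<open>F\<close> also controls the mass
  outside \<open>F\<close>. The resulting bound does not depend on the tested set, so it bounds the
  Prohorov distance.\<close>

lemma limitin_prohorov_topologyI:
  fixes \<theta> :: "nat \<Rightarrow> int measure"
  assumes th: "\<And>n. \<theta> n \<in> prob_Nb b" "\<theta>' \<in> prob_Nb b"
    and lim: "\<And>k. k \<in> Nb b \<Longrightarrow> (\<lambda>n. measure (\<theta> n) {k}) \<longlonglongrightarrow> measure \<theta>' {k}"
  shows "limitin (prohorov_topology b) \<theta> \<theta>' sequentially"
proof -
  interpret Metric_space "prob_Nb b" "prohorov b" by (rule Metric_space_prohorov)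
  interpret P: prob_space \<theta>' using th prob_NbD by blast
  have s: "sets \<theta>' = Pow (Nb b)" using th prob_NbD by auto
  have sum: "measure \<nu> F = (\<Sum>k\<in>F. measure \<nu> {k})" "measure \<nu> (Nb b - F) = 1 - measure \<nu> F"
    if "\<nu> \<in> prob_Nb b" "finite F" "F \<subseteq> Nb b" for \<nu> F
  proof -
    interpret N: prob_space \<nu> using that prob_NbD by blast
    show "measure \<nu> F = (\<Sum>k\<in>F. measure \<nu> {k})"
      using that prob_NbD(2)[OF that(1)] by (intro N.finite_measure_eq_sum_singleton) auto
    show "measure \<nu> (Nb b - F) = 1 - measure \<nu> F"
      using that prob_NbD[OF that(1)] N.prob_compl[of F] by auto
  qed
  have "\<exists>N. \<forall>n\<ge>N. prohorov b (\<theta> n) \<theta>' < e" if e: "0 < e" for e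
  proof -
    have "(\<lambda>i. measure \<theta>' {int b..<int b + int i}) \<longlonglongrightarrow> measure \<theta>' (\<Union>i. {int b..<int b + int i})"
      by (intro P.finite_Lim_measure_incseq) (auto simp: s Nb_def incseq_def)
    also have "(\<Union>i. {int b..<int b + int i}) = Nb b"
    proof -
      have "x \<in> {int b..<int b + int (nat (x + 1))}" if "int b \<le> x" for x using that by auto
      then show ?thesis by (fastforce simp: Nb_def)
    qed
    also have "measure \<theta>' (Nb b) = 1" using P.prob_space prob_NbD(3)[OF th(2)] by simp
    \<comment> \<open>With e/8 the two tails outside \<open>F\<close> in the limit of
      \<open>g\<close> below add up to less than e/4, which is under the required e/2.\<close>
    finally have "\<forall>\<^sub>F i in sequentially. 1 - e / 8 < measure \<theta>' {int b..<int b + int i}"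
      by (rule order_tendstoD) (use e in auto)
    then obtain i where i: "1 - e / 8 < measure \<theta>' {int b..<int b + int i}"
      by (auto simp: eventually_sequentially)
    define F where "F = {int b..<int b + int i}"
    have F: "finite F" "F \<subseteq> Nb b" by (auto simp: F_def Nb_def)
    \<comment> \<open>The bound of \<open>integral_diff_bound\<close> for functions with values in
      [-1,1]; it is applied to indicators.\<close>
    define g where "g n = 1 * ((\<Sum>k\<in>F. \<bar>measure (\<theta> n) {k} - measure \<theta>' {k}\<bar>)
      + measure (\<theta> n) (Nb b - F) + measure \<theta>' (Nb b - F))" for n
    have "g \<longlonglongrightarrow> 1 * ((\<Sum>k\<in>F. \<bar>measure \<theta>' {k} - measure \<theta>' {k}\<bar>)
      + measure \<theta>' (Nb b - F) + measure \<theta>' (Nb b - F))"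
      \<comment> \<open>The complement of \<open>F\<close> is infinite, so its mass is rewritten as
        1 minus a finite sum of point masses, to which \<open>lim\<close> applies.\<close>
      unfolding g_def sum(2)[OF th(1) F] sum(2)[OF th(2) F] sum(1)[OF th(1) F] sum(1)[OF th(2) F]
      using F by (intro tendsto_intros lim) auto
    moreover have "1 * ((\<Sum>k\<in>F. \<bar>measure \<theta>' {k} - measure \<theta>' {k}\<bar>)
      + measure \<theta>' (Nb b - F) + measure \<theta>' (Nb b - F)) < e / 2"
      using i e unfolding sum(2)[OF th(2) F] by (simp add: F_def)
    ultimately have "\<forall>\<^sub>F n in sequentially. g n < e / 2" by (rule order_tendstoD)
    then obtain N where N: "\<And>n. n \<ge> N \<Longrightarrow> g n < e / 2" by (auto simp: eventually_sequentially)
    have "prohorov b (\<theta> n) \<theta>' \<le> e / 2" if "n \<ge> N" for n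
    proof (rule prohorov_leI[OF th])
      fix A assume A: "A \<subseteq> Nb b"
      have "\<bar>measure (\<theta> n) A - measure \<theta>' A\<bar> \<le> g n"
        using integral_diff_bound[OF th(1)[of n] th(2) F, of "indicator A" 1]
        unfolding g_def integral_indicator_prob_Nb[OF th(1) A] integral_indicator_prob_Nb[OF th(2) A]
        by (auto simp: indicator_def)
      with N[OF that] show "\<bar>measure (\<theta> n) A - measure \<theta>' A\<bar> \<le> e / 2" by linarith
    qed (use e in simp)
    with e show ?thesis by force
  qed
  then show ?thesis
    unfolding prohorov_topology_def limit_metric_sequentially using th by simp
qed

section \<open>Compactness under a bound on the mean\<close>

text \<open>Markov's inequality for the complement. The bound depends only on \<open>c\<close> and
  \<open>K\<close>, so it is tightness uniform over all measures with mean at most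
  \<open>c\<close>.\<close>

lemma measure_atLeastLessThan_ge_mean:
  assumes \<theta>: "\<theta> \<in> prob_Nb_mean_Icc b c" and K: "0 < K"
  shows "1 - c / real_of_int K \<le> measure \<theta> {int b..<K}"
proof -
  have th: "\<theta> \<in> prob_Nb b" and int: "integrable \<theta> real_of_int" and le: "integral\<^sup>L \<theta> real_of_int \<le> c"
    using \<theta> by (auto simp: prob_Nb_mean_Icc_def)
  interpret prob_space \<theta> using th prob_NbD by blast
  have s: "sets \<theta> = Pow (Nb b)" "space \<theta> = Nb b" using th prob_NbD by auto
  have "measure \<theta> {x \<in> space \<theta>. real_of_int K \<le> real_of_int x} \<le> integral\<^sup>L \<theta> real_of_int / real_of_int K"
    using int K by (intro integral_Markov_inequality_measure[where A = "{}"] AE_I2) (auto simp: s Nb_def)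
  also have "\<dots> \<le> c / real_of_int K" using le K by (intro divide_right_mono) auto
  finally have "measure \<theta> (space \<theta> - {int b..<K}) \<le> c / real_of_int K"
    by (rule order_trans[rotated]) (auto simp: s Nb_def intro!: finite_measure_mono)
  moreover have "measure \<theta> (space \<theta> - {int b..<K}) = 1 - measure \<theta> {int b..<K}"
    by (intro prob_compl) (auto simp: s Nb_def)
  ultimately show ?thesis by linarith
qed

text \<open>Tychonoff's theorem: the topology on functions is the product topology, and the set is a
  product of copies of [0,1].\<close>

lemma compact_unit_functions: "compact {f :: int \<Rightarrow> real. \<forall>k. f k \<in> {0..1}}"
proof -
  have "compactin (product_topology (\<lambda>i::int. euclidean :: real topology) UNIV) (PiE UNIV (\<lambda>_. {0..1}))"
    by (simp add: compactin_PiE)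
  then show ?thesis
    unfolding euclidean_product_topology by (simp add: PiE_def Pi_def)
qed

theorem compactin_prob_Nb_mean_Icc:
  assumes c: "0 \<le> c"
  shows "compactin (prohorov_topology b) (prob_Nb_mean_Icc b c)"
proof -
  interpret Metric_space "prob_Nb b" "prohorov b" by (rule Metric_space_prohorov)
  have "\<exists>\<theta>' r. \<theta>' \<in> prob_Nb_mean_Icc b c \<and> strict_mono r
      \<and> limitin (prohorov_topology b) (\<theta> \<circ> r) \<theta>' sequentially"
    if range: "range \<theta> \<subseteq> prob_Nb_mean_Icc b c" for \<theta> :: "nat \<Rightarrow> int measure"
  proof -
    have \<theta>: "\<theta> n \<in> prob_Nb_mean_Icc b c" "\<theta> n \<in> prob_Nb b" for n
      using range by (auto simp: prob_Nb_mean_Icc_def)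
    \<comment> \<open>For \<open>k\<close> outside \<open>Nb b\<close> the singleton is not
      measurable and \<open>measure\<close> returns 0, so the point masses form a function on all of
      \<open>int\<close>.\<close>
    have "\<forall>n. (\<lambda>k. measure (\<theta> n) {k}) \<in> {f. \<forall>k. f k \<in> {0..1}}"
      using prob_space.prob_le_1[OF prob_NbD(1)[OF \<theta>(2)]] by auto
    \<comment> \<open>This takes the place of a diagonal argument: \<open>int\<close> is countable,
      so the function space is first countable and compactness yields convergent
      subsequences.\<close>
    from seq_compactE[OF compact_imp_seq_compact[OF compact_unit_functions] this]
    obtain p r where "p \<in> {f. \<forall>k. f k \<in> {0..1}}" and r: "strict_mono r"
      and tendsto: "((\<lambda>n k. measure (\<theta> n) {k}) \<circ> r) \<longlonglongrightarrow> p" .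
    then have p: "\<And>k. p k \<in> {0..1}" by blast
    from tendsto have lim: "(\<lambda>n. measure (\<theta> (r n)) {k}) \<longlonglongrightarrow> p k" for k
      using continuous_on_tendsto_compose[OF continuous_on_product_coordinates[of k]]
      by (force simp: comp_def)
    interpret N: prob_space "\<theta> (r n)" for n using prob_NbD(1)[OF \<theta>(2)] .
    have elim: "(\<lambda>n. emeasure (\<theta> (r n)) {k}) \<longlonglongrightarrow> ennreal (p k)" for k
      unfolding N.emeasure_eq_measure by (rule tendsto_ennrealI[OF lim])
    \<comment> \<open>Used twice: with f = 1 for the total mass and with the identity for the mean.
      Finiteness of \<open>f k\<close> makes the product converge even where \<open>p k\<close> is
      0.\<close>
    have fatou: "(\<integral>\<^sup>+k. ennreal (p k) * f k \<partial>count_space (Nb b)) \<le> a"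
      if f: "\<And>k. f k \<noteq> \<top>" and a: "\<And>n. integral\<^sup>N (\<theta> n) f \<le> a" for f a
    proof -
      have "(\<integral>\<^sup>+k. ennreal (p k) * f k \<partial>count_space (Nb b)) =
          (\<integral>\<^sup>+k. liminf (\<lambda>n. emeasure (\<theta> (r n)) {k} * f k) \<partial>count_space (Nb b))"
        using f by (intro nn_integral_cong lim_imp_Liminf[symmetric] tendsto_mult_ennreal elim tendsto_const) auto
      also have "\<dots> \<le> liminf (\<lambda>n. \<integral>\<^sup>+k. emeasure (\<theta> (r n)) {k} * f k \<partial>count_space (Nb b))"
        by (rule nn_integral_liminf) simp
      also have "\<dots> = liminf (\<lambda>n. integral\<^sup>N (\<theta> (r n)) f)"
        by (simp add: nn_integral_prob_Nb[OF \<theta>(2)])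
      also have "\<dots> \<le> a" using a by (intro Liminf_le) auto
      finally show ?thesis .
    qed
    have "(\<integral>\<^sup>+k. ennreal (p k) \<partial>count_space (Nb b)) = 1"
    proof (rule antisym)
      show "(\<integral>\<^sup>+k. ennreal (p k) \<partial>count_space (Nb b)) \<le> 1"
        using fatou[of "\<lambda>_. 1" 1] prob_space.emeasure_space_1[OF prob_NbD(1)[OF \<theta>(2)]] by auto
      \<comment> \<open>No mass escapes: the bound on {b..<K} is uniform in \<open>n\<close> and
        passes to the limit through a finite sum. Letting \<open>K\<close> run through the positive
        integers \<open>Suc n\<close> then gives total mass at least 1.\<close>
      have ge: "ennreal (1 - c / real_of_int K) \<le> (\<integral>\<^sup>+k. ennreal (p k) \<partial>count_space (Nb b))"
        if K: "0 < K" for K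
      proof -
        have "1 - c / real_of_int K \<le> (\<Sum>k\<in>{int b..<K}. measure (\<theta> (r n)) {k})" for n
          using measure_atLeastLessThan_ge_mean[OF \<theta>(1) K, of "r n"] prob_NbD(2)[OF \<theta>(2), of "r n"]
          by (subst N.finite_measure_eq_sum_singleton[symmetric]) (auto simp: Nb_def)
        then have "1 - c / real_of_int K \<le> (\<Sum>k\<in>{int b..<K}. p k)"
          by (intro tendsto_lowerbound[OF tendsto_sum[OF lim]]) auto
        then have "ennreal (1 - c / real_of_int K) \<le> (\<Sum>k\<in>{int b..<K}. ennreal (p k))"
          using p by (subst sum_ennreal) (auto intro: ennreal_leI)
        also have "\<dots> = (\<integral>\<^sup>+k. ennreal (p k) \<partial>count_space {int b..<K})"
          by (rule nn_integral_count_space_finite[symmetric]) simp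
        also have "\<dots> \<le> (\<integral>\<^sup>+k. ennreal (p k) \<partial>count_space (Nb b))"
          by (auto simp: nn_integral_count_space_indicator Nb_def indicator_def intro!: nn_integral_mono)
        finally show ?thesis .
      qed
      have "(\<lambda>n. ennreal (1 - c / real_of_int (int (Suc n)))) \<longlonglongrightarrow> ennreal (1 - 0)"
        unfolding of_int_of_nat_eq
        by (intro tendsto_ennrealI tendsto_diff tendsto_const LIMSEQ_Suc lim_const_over_n)
      then have "ennreal (1 - 0) \<le> (\<integral>\<^sup>+k. ennreal (p k) \<partial>count_space (Nb b))"
        by (rule LIMSEQ_le_const2) (intro exI allI impI ge, simp)
      then show "1 \<le> (\<integral>\<^sup>+k. ennreal (p k) \<partial>count_space (Nb b))" by simp
    qed
    define \<theta>' where "\<theta>' = density (count_space (Nb b)) (\<lambda>k. ennreal (p k))"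
    have \<theta>': "\<theta>' \<in> prob_Nb b"
      unfolding \<theta>'_def by (rule density_in_prob_Nb) fact
    moreover have "(\<integral>\<^sup>+k. ennreal (real_of_int k) \<partial>\<theta>') \<le> ennreal c"
      unfolding \<theta>'_def using \<theta>(1) prob_Nb_mean_Icc_iff[OF c]
      by (subst nn_integral_density) (simp_all add: fatou)
    ultimately have "\<theta>' \<in> prob_Nb_mean_Icc b c"
      using prob_Nb_mean_Icc_iff[OF c] by blast
    moreover have "measure \<theta>' {k} = p k" if "k \<in> Nb b" for k
      using that p by (simp add: \<theta>'_def measure_def emeasure_density_count_space_singleton)
    then have "limitin (prohorov_topology b) (\<theta> \<circ> r) \<theta>' sequentially"
      using \<theta> \<theta>' lim by (intro limitin_prohorov_topologyI) auto
    ultimately show ?thesis using r by blast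
  qed
  then show ?thesis
    unfolding prohorov_topology_def compactin_sequentially
    by (auto simp: prob_Nb_mean_Icc_def)
qed

section \<open>Mixtures with a remote point mass\<close>

text \<open>The mixture $(1 - t) \theta + t \delta_k$.\<close>

definition mix_point :: "nat \<Rightarrow> real \<Rightarrow> int \<Rightarrow> int measure \<Rightarrow> int measure"
  where "mix_point b t k \<theta> = density (count_space (Nb b))
    (\<lambda>x. ennreal (1 - t) * emeasure \<theta> {x} + ennreal t * indicator {k} x)"

lemma nn_integral_mix_point:
  assumes "\<theta> \<in> prob_Nb b" "k \<in> Nb b"
  shows "integral\<^sup>N (mix_point b t k \<theta>) f = ennreal (1 - t) * integral\<^sup>N \<theta> f + ennreal t * f k"
proof -
  have "integral\<^sup>N (mix_point b t k \<theta>) f = (\<integral>\<^sup>+x. ennreal (1 - t) * (emeasure \<theta> {x} * f x)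
      + ennreal t * f k * indicator {k} x \<partial>count_space (Nb b))"
    unfolding mix_point_def
    by (subst nn_integral_density)
      (auto intro!: nn_integral_cong simp: indicator_def distrib_right mult.assoc)
  also have "\<dots> = ennreal (1 - t) * integral\<^sup>N \<theta> f + ennreal t * f k"
    using assms by (simp add: nn_integral_add nn_integral_cmult nn_integral_prob_Nb nn_integral_cmult_indicator)
  finally show ?thesis .
qed

lemma mix_point_in_prob_Nb:
  assumes "\<theta> \<in> prob_Nb b" "k \<in> Nb b" "t \<in> {0..1}"
  shows "mix_point b t k \<theta> \<in> prob_Nb b"
proof -
  have "(\<integral>\<^sup>+x. 1 \<partial>mix_point b t k \<theta>) = ennreal (1 - t) * (\<integral>\<^sup>+x. 1 \<partial>\<theta>) + ennreal t"
    using nn_integral_mix_point[OF assms(1,2), of t "\<lambda>_. 1"] by simp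
  also have "\<dots> = 1"
    using assms(3) prob_space.emeasure_space_1[OF prob_NbD(1)[OF assms(1)]]
    by (simp flip: ennreal_plus)
  finally show ?thesis
    unfolding mix_point_def by (intro density_in_prob_Nb) (simp add: nn_integral_density del: nn_integral_const)
qed

lemma measure_mix_point:
  assumes "\<theta> \<in> prob_Nb b" "k \<in> Nb b" "t \<in> {0..1}" "A \<subseteq> Nb b"
  shows "measure (mix_point b t k \<theta>) A = (1 - t) * measure \<theta> A + t * indicator A k"
proof -
  interpret M: prob_space \<theta> using assms prob_NbD by blast
  note mix = mix_point_in_prob_Nb[OF assms(1-3)]
  interpret N: prob_space "mix_point b t k \<theta>" using mix prob_NbD by blast
  have "ennreal (measure (mix_point b t k \<theta>) A) = (\<integral>\<^sup>+x. indicator A x \<partial>mix_point b t k \<theta>)"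
    using assms prob_NbD(2)[OF mix] by (simp add: N.emeasure_eq_measure)
  also have "\<dots> = ennreal (1 - t) * (\<integral>\<^sup>+x. indicator A x \<partial>\<theta>) + ennreal t * indicator A k"
    by (rule nn_integral_mix_point[OF assms(1,2)])
  also have "\<dots> = ennreal ((1 - t) * measure \<theta> A + t * indicator A k)"
  proof -
    have "(\<integral>\<^sup>+x. indicator A x \<partial>\<theta>) = ennreal (measure \<theta> A)"
      using assms(4) prob_NbD(2)[OF assms(1)] by (simp add: M.emeasure_eq_measure)
    then show ?thesis
      using assms(3) by (cases "k \<in> A") (auto simp: ennreal_mult')
  qed
  finally show ?thesis using assms(3) by (simp add: ennreal_inj del: ennreal_plus)
qed

lemma prob_Nb_mean_Icc_subset_closure:
  assumes c: "real b < c"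
  shows "prob_Nb_mean_Icc b c \<subseteq> prohorov_topology b closure_of prob_Nb_mean b c"
proof
  interpret Metric_space "prob_Nb b" "prohorov b" by (rule Metric_space_prohorov)
  fix \<theta> assume "\<theta> \<in> prob_Nb_mean_Icc b c"
  then obtain m where th: "\<theta> \<in> prob_Nb b" and mean: "\<theta> \<in> prob_Nb_mean b m" and m: "real b \<le> m" "m \<le> c"
    by (auto simp: prob_Nb_mean_Icc_def prob_Nb_mean_def)
  \<comment> \<open>Starting beyond \<open>c\<close> puts the points n + N into \<open>Nb b\<close>,
    makes the denominators of \<open>t\<close> positive and gives t \<le> 1.\<close>
  obtain N where N: "c < real N" using reals_Archimedean2 by blast
  \<comment> \<open>The solution of (1 - t) m + t (n + N) = c.\<close>
  define t where "t n = (c - m) / (real (n + N) - m)" for n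
  define \<nu> where "\<nu> n = mix_point b (t n) (int (n + N)) \<theta>" for n
  have pos: "0 < real (n + N) - m" for n using N m by simp
  have t: "t n \<in> {0..1}" for n
    using pos[of n] N m by (auto simp: t_def field_simps)
  have k: "int (n + N) \<in> Nb b" for n using N c by (auto simp: Nb_def)
  have "(\<integral>\<^sup>+x. ennreal (real_of_int x) \<partial>\<nu> n) = ennreal c" for n
  proof -
    have "(\<integral>\<^sup>+x. ennreal (real_of_int x) \<partial>\<nu> n) = ennreal (1 - t n) * ennreal m + ennreal (t n) * ennreal (real (n + N))"
      using mean m prob_Nb_mean_iff[of m \<theta> b] unfolding \<nu>_def
      by (subst nn_integral_mix_point[OF th k]) auto
    also have "\<dots> = ennreal ((1 - t n) * m + t n * real (n + N))"
      using t[of n] m by (subst ennreal_plus) (auto simp: ennreal_mult)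
    also have "(1 - t n) * m + t n * real (n + N) = m + t n * (real (n + N) - m)"
      by (simp add: algebra_simps)
    also have "\<dots> = c" using pos[of n] by (simp add: t_def)
    finally show ?thesis .
  qed
  moreover have \<nu>: "\<nu> n \<in> prob_Nb b" for n
    unfolding \<nu>_def by (rule mix_point_in_prob_Nb[OF th k t])
  ultimately have "\<nu> n \<in> prob_Nb_mean b c" for n
    using c prob_Nb_mean_iff[of c] by auto
  moreover have "limitin (prohorov_topology b) \<nu> \<theta> sequentially"
  proof (rule limitin_prohorov_topologyI[OF \<nu> th])
    fix j assume j: "j \<in> Nb b"
    have "t \<longlonglongrightarrow> 0" unfolding t_def by real_asymp
    then have *: "(\<lambda>n. (1 - t n) * measure \<theta> {j}) \<longlonglongrightarrow> (1 - 0) * measure \<theta> {j}"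
      by (intro tendsto_intros)
    \<comment> \<open>The added mass at \<open>j\<close> is squeezed between 0 and
      \<open>t n\<close>.\<close>
    have "(\<lambda>n. t n * indicator {j} (int (n + N))) \<longlonglongrightarrow> 0"
      using \<open>t \<longlonglongrightarrow> 0\<close> t
      by (intro tendsto_sandwich[OF _ _ tendsto_const \<open>t \<longlonglongrightarrow> 0\<close>] always_eventually)
        (auto simp: indicator_def)
    from tendsto_add[OF * this] show "(\<lambda>n. measure (\<nu> n) {j}) \<longlonglongrightarrow> measure \<theta> {j}"
      using j unfolding \<nu>_def by (simp add: measure_mix_point[OF th k t] del: of_nat_add)
  qed
  ultimately show "\<theta> \<in> prohorov_topology b closure_of prob_Nb_mean b c"
    using th \<nu> unfolding prohorov_topology_def closure_of_sequentially by blast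
qed

section \<open>Closure, separability and failure of closedness\<close>

text \<open>Relative compactness is expressed as compactness of the closure, and completeness refers
  to the Prohorov metric restricted to the subset.\<close>

theorem theorem2p4:
  fixes b :: nat and c :: real
  assumes "real b < c"
  shows
    "(prob_Nb_mean b c \<subseteq> prob_Nb b
      \<and> compactin (prohorov_topology b) (prohorov_topology b closure_of prob_Nb_mean b c)
      \<and> separable_space (subtopology (prohorov_topology b) (prob_Nb_mean b c))
      \<and> \<not> closedin (prohorov_topology b) (prob_Nb_mean b c)
      \<and> \<not> compactin (prohorov_topology b) (prob_Nb_mean b c)
      \<and> \<not> Metric_space.mcomplete (prob_Nb_mean b c) (prohorov b))
     \<and>
     (prob_Nb_mean_Icc b c = prohorov_topology b closure_of prob_Nb_mean b c
      \<and> compactin (prohorov_topology b) (prob_Nb_mean_Icc b c)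
      \<and> separable_space (subtopology (prohorov_topology b) (prob_Nb_mean_Icc b c)))"
proof -
  interpret Metric_space "prob_Nb b" "prohorov b" by (rule Metric_space_prohorov)
  have sub: "prob_Nb_mean b c \<subseteq> prob_Nb b" "prob_Nb_mean b c \<subseteq> prob_Nb_mean_Icc b c"
    using assms by (auto simp: prob_Nb_mean_def prob_Nb_mean_Icc_def)
  interpret Submetric "prob_Nb b" "prohorov b" "prob_Nb_mean b c"
    by unfold_locales (rule sub)
  have compact: "compactin (prohorov_topology b) (prob_Nb_mean_Icc b c)"
    using assms by (intro compactin_prob_Nb_mean_Icc) auto
  have Hausdorff: "Hausdorff_space (prohorov_topology b)"
    unfolding prohorov_topology_def by (rule Hausdorff_space_mtopology)
  \<comment> \<open>One inclusion is the approximation by mixtures; for the other, a compact set in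
    a Hausdorff space is closed.\<close>
  have closure: "prob_Nb_mean_Icc b c = prohorov_topology b closure_of prob_Nb_mean b c"
    using prob_Nb_mean_Icc_subset_closure[OF assms]
      closure_of_minimal[OF sub(2) compactin_imp_closedin[OF Hausdorff compact]] by blast
  \<comment> \<open>Total boundedness, unlike compactness, passes to arbitrary subsets, so it yields
    separability of both sets.\<close>
  have bounded: "mtotally_bounded (prob_Nb_mean_Icc b c)"
    using compact unfolding prohorov_topology_def by (rule compactin_imp_mtotally_bounded)
  have separable: "separable_space (subtopology (prohorov_topology b) (prob_Nb_mean_Icc b c))"
    "separable_space (subtopology (prohorov_topology b) (prob_Nb_mean b c))"
    unfolding prohorov_topology_def
    by (intro mtotally_bounded_imp_separable_space bounded mtotally_bounded_subset[OF bounded sub(2)])+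
  \<comment> \<open>The point mass at \<open>b\<close> has mean b < c, so it lies in the closure but
    not in the set.\<close>
  define \<delta> where "\<delta> = return (count_space (Nb b)) (int b)"
  have b: "int b \<in> Nb b" by (simp add: Nb_def)
  have "\<delta> \<in> prob_Nb b"
    using b by (auto simp: prob_Nb_def \<delta>_def intro: prob_space_return)
  moreover have "(\<integral>\<^sup>+x. ennreal (real_of_int x) \<partial>\<delta>) = ennreal (real b)"
    using b unfolding \<delta>_def by (subst nn_integral_return) auto
  ultimately have "\<delta> \<in> prob_Nb_mean_Icc b c" "\<delta> \<notin> prob_Nb_mean b c"
    using assms prob_Nb_mean_iff[of c \<delta> b] prob_Nb_mean_Icc_iff[of c \<delta> b] by (auto intro: ennreal_leI)
  then have not_closed: "\<not> closedin (prohorov_topology b) (prob_Nb_mean b c)"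
    unfolding closure using closure_of_closedin by blast
  then have "\<not> compactin (prohorov_topology b) (prob_Nb_mean b c)"
    using compactin_imp_closedin[OF Hausdorff] by blast
  \<comment> \<open>A subset that is complete in the restricted metric would be closed.\<close>
  moreover have "\<not> Metric_space.mcomplete (prob_Nb_mean b c) (prohorov b)"
    using not_closed mcomplete_imp_closedin unfolding prohorov_topology_def by blast
  ultimately show ?thesis
    using sub compact closure separable not_closed by simp
qed

end
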